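(* Let $d\ge1$, let $0\le u_0\in\mathcal{M}_0(\mathbb{R}^d)$ and let $$u(x,t)=\frac{1}{(4\pi t)^{d/2}}\int_{\mathbb{R}^d}e^{-|x-y|^2/4t}\,\mathrm{d}u_0(y),\qquad x\in\mathbb{R}^d,\ t>0.$$ Then $u$ is bounded on the sets $\{(x,t):t>0,\ |x|^2/t\le R\}$, $R>0$, if and only if $$\sup_{\varepsilon>0}\|u_0\|_{\mathcal{M}_\varepsilon(\mathbb{R}^d)}<\infty .$$
   Context: $\mathcal{M}_{\rm loc}(\mathbb{R}^d)$ is the set of (signed) Radon measures on $\mathbb{R}^d$, identified with the dual of $C_c(\mathbb{R}^d)$; $|\mu|=\mu^++\mu^-$ is the total variation measure. For $\varepsilon>0$, $\mathcal{M}_\varepsilon(\mathbb{R}^d)=\{\mu\in\mathcal{M}_{\rm loc}(\mathbb{R}^d):\int e^{-\varepsilon|x|^2}\,\mathrm{d}|\mu|(x)<\infty\}$ with norm $\|\mu\|_{\mathcal{M}_\varepsilon(\mathbb{R}^d)}=\left(\frac{\varepsilon}{\pi}\right)^{d/2}\int_{\mathbb{R}^d}e^{-\varepsilon|x|^2}\,\mathrm{d}|\mu|(x)$, and $\mathcal{M}_0(\mathbb{R}^d)=\bigcap_{\varepsilon>0}\mathcal{M}_\varepsilon(\mathbb{R}^d)$. *)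

theory Defs
  imports "HOL-Analysis.Analysis"
begin

text \<open>
  The space \<open>\<real>\<^sup>d\<close> is an arbitrary Euclidean space \<open>'a\<close> with \<open>d = DIM('a)\<close>, so \<open>d \<ge> 1\<close> holds by
  the type class. Nonnegative elements of the dual of \<open>C\<^sub>c(\<real>\<^sup>d)\<close> are, by Riesz representation,
  the Borel measures that are finite on compact sets (regularity is automatic on \<open>\<real>\<^sup>d\<close>). Only such
  measures are considered, so the total variation \<open>\<bar>\<mu>\<bar>\<close> is \<open>\<mu>\<close> itself.
\<close>

definition radon_measure :: "'a::euclidean_space measure \<Rightarrow> bool" where
  "radon_measure \<mu> \<longleftrightarrow>
     sets \<mu> = sets borel \<and> (\<forall>K. compact K \<longrightarrow> emeasure \<mu> K < \<infinity>)"

definition gauss_norm :: "real \<Rightarrow> 'a::euclidean_space measure \<Rightarrow> ennreal" where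
  "gauss_norm \<epsilon> \<mu> =
     ennreal ((\<epsilon> / pi) powr (real DIM('a) / 2)) *
     (\<integral>\<^sup>+ x. ennreal (exp (- \<epsilon> * (norm x)\<^sup>2)) \<partial>\<mu>)"

text \<open>The cones of nonnegative elements of \<open>\<M>\<^sub>\<epsilon>(\<real>\<^sup>d)\<close> and \<open>\<M>\<^sub>0(\<real>\<^sup>d)\<close>.\<close>

definition M_eps_nonneg :: "real \<Rightarrow> 'a::euclidean_space measure set" where
  "M_eps_nonneg \<epsilon> =
     {\<mu>. radon_measure \<mu> \<and> (\<integral>\<^sup>+ x. ennreal (exp (- \<epsilon> * (norm x)\<^sup>2)) \<partial>\<mu>) < \<infinity>}"

definition M_zero_nonneg :: "'a::euclidean_space measure set" where
  "M_zero_nonneg = (\<Inter>\<epsilon>\<in>{0<..}. M_eps_nonneg \<epsilon>)"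

text \<open>For \<open>\<mu>\<close> in \<open>M_zero_nonneg\<close> and \<open>t > 0\<close> the integrand is integrable, so the Bochner
  integral never takes its default value there.\<close>

definition heat_extension :: "'a::euclidean_space measure \<Rightarrow> 'a \<Rightarrow> real \<Rightarrow> real" where
  "heat_extension \<mu> x t =
     1 / (4 * pi * t) powr (real DIM('a) / 2) *
     (\<integral>y. exp (- (norm (x - y))\<^sup>2 / (4 * t)) \<partial>\<mu>)"

end

theory Submission imports Defs begin

text \<open>
  At the origin the heat extension at time \<open>t\<close> is exactly the Gaussian norm with
  \<open>\<epsilon> = 1 / (4 t)\<close>, so a bound for \<open>u\<close> on any of the parabolic regions \<open>\<bar>x\<bar>\<^sup>2 / t \<le> R\<close>, all of
  which contain the half line \<open>x = 0\<close>, bounds every Gaussian norm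
  (\<open>heat_extension_origin\<close>).

  Conversely, moving the centre of a Gaussian from \<open>x\<close> to the origin costs, after halving the
  exponent, only the factor \<open>exp (\<bar>x\<bar>\<^sup>2 / (4 t))\<close>, which is at most \<open>exp (R / 4)\<close> on the
  parabolic region. Halving the exponent replaces \<open>\<epsilon> = 1 / (4 t)\<close> by \<open>1 / (8 t)\<close> and changes the
  normalising constant by \<open>2 powr (d / 2)\<close>, whatever \<open>t\<close> is. Hence \<open>u\<close> is bounded there by a
  constant times the supremum of the Gaussian norms (\<open>heat_extension_le_gauss_norm\<close>).
\<close>

text \<open>This is \<open>\<bar>y\<bar>\<^sup>2 \<le> 2 \<bar>x - y\<bar>\<^sup>2 + 2 \<bar>x\<bar>\<^sup>2\<close> in exponential form.\<close>

lemma gaussian_recentre: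
  fixes x y :: "'a::real_normed_vector"
  assumes "t > 0"
  shows "exp (- (norm (x - y))\<^sup>2 / (4 * t))
           \<le> exp ((norm x)\<^sup>2 / (4 * t)) * exp (- (1 / (8 * t)) * (norm y)\<^sup>2)"
proof -
  have "norm y \<le> norm (x - y) + norm x"
    using norm_triangle_ineq[of "y - x" x] by (simp add: norm_minus_commute)
  then have "(norm y)\<^sup>2 \<le> (norm (x - y) + norm x)\<^sup>2"
    by (intro power_mono) auto
  also have "\<dots> \<le> 2 * (norm (x - y))\<^sup>2 + 2 * (norm x)\<^sup>2"
    using zero_le_power2[of "norm (x - y) - norm x"]
    unfolding power2_sum power2_diff by linarith
  finally have "- (norm (x - y))\<^sup>2 / (4 * t)
      \<le> (norm x)\<^sup>2 / (4 * t) + (- (1 / (8 * t)) * (norm y)\<^sup>2)"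
    using assms by (simp add: field_simps)
  then show ?thesis
    by (simp flip: exp_add)
qed

lemma nn_integral_heat_kernel_le:
  fixes \<mu> :: "'a::euclidean_space measure"
  assumes "sets \<mu> = sets borel" "t > 0"
  shows "(\<integral>\<^sup>+ y. ennreal (exp (- (norm (x - y))\<^sup>2 / (4 * t))) \<partial>\<mu>)
           \<le> ennreal (exp ((norm x)\<^sup>2 / (4 * t)))
               * (\<integral>\<^sup>+ y. ennreal (exp (- (1 / (8 * t)) * (norm y)\<^sup>2)) \<partial>\<mu>)"
proof -
  have [measurable_cong]: "sets \<mu> = sets borel" by fact
  have "(\<integral>\<^sup>+ y. ennreal (exp (- (norm (x - y))\<^sup>2 / (4 * t))) \<partial>\<mu>)
      \<le> (\<integral>\<^sup>+ y. ennreal (exp ((norm x)\<^sup>2 / (4 * t)))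
               * ennreal (exp (- (1 / (8 * t)) * (norm y)\<^sup>2)) \<partial>\<mu>)"
    unfolding ennreal_mult'[OF exp_ge_zero, symmetric]
    by (intro nn_integral_mono ennreal_leI gaussian_recentre \<open>t > 0\<close>)
  also have "\<dots> = ennreal (exp ((norm x)\<^sup>2 / (4 * t)))
               * (\<integral>\<^sup>+ y. ennreal (exp (- (1 / (8 * t)) * (norm y)\<^sup>2)) \<partial>\<mu>)"
    by (rule nn_integral_cmult) measurable
  finally show ?thesis .
qed

text \<open>The comparison with a Gaussian centred at the origin also gives integrability of the heat
  kernel, so that the Bochner integral may be replaced by the nonnegative one.\<close>

lemma ennreal_heat_extension:
  fixes \<mu> :: "'a::euclidean_space measure"
  assumes "\<mu> \<in> M_zero_nonneg" "t > 0"
  shows "ennreal (heat_extension \<mu> x t)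
           = ennreal (1 / (4 * pi * t) powr (real DIM('a) / 2))
               * (\<integral>\<^sup>+ y. ennreal (exp (- (norm (x - y))\<^sup>2 / (4 * t))) \<partial>\<mu>)"
proof -
  have "\<mu> \<in> M_eps_nonneg (1 / (8 * t))"
    using assms by (simp add: M_zero_nonneg_def)
  then have [measurable_cong]: "sets \<mu> = sets borel"
    and fin: "(\<integral>\<^sup>+ y. ennreal (exp (- (1 / (8 * t)) * (norm y)\<^sup>2)) \<partial>\<mu>) < \<infinity>"
    unfolding M_eps_nonneg_def radon_measure_def by blast+
  have "(\<integral>\<^sup>+ y. ennreal (exp (- (norm (x - y))\<^sup>2 / (4 * t))) \<partial>\<mu>) < \<infinity>"
    using fin by (intro le_less_trans[OF nn_integral_heat_kernel_le])
      (auto simp: assms \<open>sets \<mu> = sets borel\<close> ennreal_mult_less_top)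
  then have "integrable \<mu> (\<lambda>y. exp (- (norm (x - y))\<^sup>2 / (4 * t)))"
    by (intro integrableI_nonneg) auto
  then have "ennreal (\<integral>y. exp (- (norm (x - y))\<^sup>2 / (4 * t)) \<partial>\<mu>)
      = (\<integral>\<^sup>+ y. ennreal (exp (- (norm (x - y))\<^sup>2 / (4 * t))) \<partial>\<mu>)"
    by (intro nn_integral_eq_integral[symmetric]) auto
  then show ?thesis
    unfolding heat_extension_def by (subst ennreal_mult') auto
qed

lemma heat_extension_nonneg: "heat_extension \<mu> x t \<ge> 0"
  unfolding heat_extension_def by (intro mult_nonneg_nonneg integral_nonneg) auto

lemma heat_extension_origin:
  fixes \<mu> :: "'a::euclidean_space measure"
  assumes "\<mu> \<in> M_zero_nonneg" "t > 0"
  shows "ennreal (heat_extension \<mu> 0 t) = gauss_norm (1 / (4 * t)) \<mu>"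
proof -
  have "1 / (4 * pi * t) powr (real DIM('a) / 2) = (1 / (4 * t) / pi) powr (real DIM('a) / 2)"
    using assms by (simp add: powr_divide mult_ac)
  then show ?thesis
    by (simp add: ennreal_heat_extension[OF assms] gauss_norm_def)
qed

lemma heat_extension_le_gauss_norm:
  fixes \<mu> :: "'a::euclidean_space measure"
  assumes "\<mu> \<in> M_zero_nonneg" "t > 0"
  shows "ennreal (heat_extension \<mu> x t)
           \<le> ennreal (2 powr (real DIM('a) / 2) * exp ((norm x)\<^sup>2 / (4 * t)))
               * gauss_norm (1 / (8 * t)) \<mu>"
proof -
  have sets: "sets \<mu> = sets borel"
    using assms unfolding M_zero_nonneg_def M_eps_nonneg_def radon_measure_def by force
  have "1 / (4 * pi * t) powr (real DIM('a) / 2) = (2 * (1 / (8 * t) / pi)) powr (real DIM('a) / 2)"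
    using assms by (simp add: powr_divide mult_ac)
  also have "\<dots> = 2 powr (real DIM('a) / 2) * (1 / (8 * t) / pi) powr (real DIM('a) / 2)"
    by (intro powr_mult)
  finally have c: "1 / (4 * pi * t) powr (real DIM('a) / 2)
      = 2 powr (real DIM('a) / 2) * (1 / (8 * t) / pi) powr (real DIM('a) / 2)" .
  have "ennreal (heat_extension \<mu> x t)
      \<le> ennreal (1 / (4 * pi * t) powr (real DIM('a) / 2))
          * (ennreal (exp ((norm x)\<^sup>2 / (4 * t)))
              * (\<integral>\<^sup>+ y. ennreal (exp (- (1 / (8 * t)) * (norm y)\<^sup>2)) \<partial>\<mu>))"
    unfolding ennreal_heat_extension[OF assms]
    by (intro mult_left_mono nn_integral_heat_kernel_le sets assms) auto
  also have "\<dots> = ennreal (2 powr (real DIM('a) / 2) * exp ((norm x)\<^sup>2 / (4 * t)))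
               * gauss_norm (1 / (8 * t)) \<mu>"
    unfolding c gauss_norm_def by (simp add: ennreal_mult' mult_ac)
  finally show ?thesis .
qed

theorem mainTheorem5:
  fixes u0 :: "'a::euclidean_space measure"
  assumes "u0 \<in> M_zero_nonneg"
  shows "(\<forall>R>0. bounded ((\<lambda>(x, t). heat_extension u0 x t) ` {(x, t). t > 0 \<and> (norm x)\<^sup>2 / t \<le> R}))
     \<longleftrightarrow> (SUP \<epsilon>\<in>{0<..}. gauss_norm \<epsilon> u0) < \<infinity>"
    (is "?L \<longleftrightarrow> ?S < \<infinity>")
proof
  assume ?L
  then have "bounded ((\<lambda>(x, t). heat_extension u0 x t) ` {(x, t). t > 0 \<and> (norm x)\<^sup>2 / t \<le> 1})"
    by simp
  then obtain B where
    "\<forall>v \<in> (\<lambda>(x, t). heat_extension u0 x t) ` {(x, t). t > 0 \<and> (norm x)\<^sup>2 / t \<le> 1}. norm v \<le> B"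
    unfolding bounded_iff by blast
  then have B: "norm (heat_extension u0 0 t) \<le> B" if "t > 0" for t
    using that by force
  have "?S \<le> ennreal B"
  proof (rule SUP_least)
    fix \<epsilon> :: real
    assume "\<epsilon> \<in> {0<..}"
    then have "gauss_norm \<epsilon> u0 = ennreal (heat_extension u0 0 (1 / (4 * \<epsilon>)))"
      using heat_extension_origin[OF assms, of "1 / (4 * \<epsilon>)"] by simp
    then show "gauss_norm \<epsilon> u0 \<le> ennreal B"
      using B[of "1 / (4 * \<epsilon>)"] \<open>\<epsilon> \<in> {0<..}\<close> by (simp add: ennreal_leI)
  qed
  then show "?S < \<infinity>"
    by (rule le_less_trans) simp
next
  assume fin: "?S < \<infinity>"
  show ?L
  proof (intro allI impI)
    fix R :: real
    assume "R > 0"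
    let ?C = "2 powr (real DIM('a) / 2) * exp (R / 4)"
    have "norm (heat_extension u0 x t) \<le> ?C * enn2real ?S"
      if "t > 0" "(norm x)\<^sup>2 / t \<le> R" for x t
    proof -
      have "ennreal (heat_extension u0 x t)
          \<le> ennreal (2 powr (real DIM('a) / 2) * exp ((norm x)\<^sup>2 / (4 * t)))
              * gauss_norm (1 / (8 * t)) u0"
        by (rule heat_extension_le_gauss_norm[OF assms \<open>t > 0\<close>])
      also have "\<dots> \<le> ennreal ?C * ?S"
      proof (intro mult_mono)
        have "(norm x)\<^sup>2 / (4 * t) \<le> R / 4"
          using that by (simp add: field_simps)
        then show "ennreal (2 powr (real DIM('a) / 2) * exp ((norm x)\<^sup>2 / (4 * t))) \<le> ennreal ?C"
          by (intro ennreal_leI mult_left_mono) auto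
        show "gauss_norm (1 / (8 * t)) u0 \<le> ?S"
          using \<open>t > 0\<close> by (intro SUP_upper) auto
      qed auto
      also have "\<dots> = ennreal (?C * enn2real ?S)"
        using fin by (simp add: ennreal_mult' ennreal_enn2real)
      finally show ?thesis
        by (subst (asm) ennreal_le_iff) (auto simp: heat_extension_nonneg)
    qed
    then show "bounded ((\<lambda>(x, t). heat_extension u0 x t) ` {(x, t). t > 0 \<and> (norm x)\<^sup>2 / t \<le> R})"
      unfolding bounded_iff by (intro exI[of _ "?C * enn2real ?S"]) auto
  qed
qed

end
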